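(* Let $\mathcal H$ be a real Hilbert space and let $A:\mathcal H\to 2^{\mathcal H}$ be a maximally monotone operator such that $S=A^{-1}(0)\neq\emptyset$. Let $s>0$, $\alpha>2$, and $\lambda_k=(1+\epsilon)\frac{s}{\alpha^2}k^2$ for some $\epsilon>\frac{2}{\alpha-2}$ and all $k\ge1$. Let $(x_k)$ be a sequence generated, from arbitrary $x_0,x_1\in\mathcal H$, by the Regularized Inertial Proximal Algorithm: for all $k\ge 1$, $$\left\{\begin{array}{rcl} y_k&=&x_k+\left(1-\frac{\alpha}{k}\right)(x_k-x_{k-1}),\\ x_{k+1}&=&\frac{\lambda_k}{\lambda_k+s}\,y_k+\frac{s}{\lambda_k+s}\left(I+(\lambda_k+s)A\right)^{-1}(y_k).\end{array}\right.$$ Then: (i) the speed tends to zero; more precisely, $\|x_{k+1}-x_k\|=\mathcal O(\frac1k)$ and $\sum_k k\|x_k-x_{k-1}\|^2<+\infty$; (ii) the sequence $(x_k)$ converges weakly, as $k\to+\infty$, to some $\hat x\in S$; (iii) the sequence $(y_k)$ converges weakly, as $k\to+\infty$, to $\hat x$.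
   Context: $S=A^{-1}(0)=\{z\in\mathcal H:0\in Az\}$. For $\mu>0$, $(I+\mu A)^{-1}$ denotes the resolvent of $A$ with index $\mu$ (single-valued and everywhere defined since $A$ is maximally monotone). *)

theory Defs
  imports "HOL-Analysis.Analysis" "HOL-Library.Landau_Symbols"
begin

text \<open>A set-valued operator on a space \<open>H\<close> is a function \<open>H \<Rightarrow> H set\<close>; a real Hilbert space is
  a type of sort \<open>{real_inner, complete_space}\<close>.\<close>

definition monotone_op :: "('a::real_inner \<Rightarrow> 'a set) \<Rightarrow> bool" where
  "monotone_op A \<longleftrightarrow> (\<forall>x y. \<forall>u\<in>A x. \<forall>v\<in>A y. inner (x - y) (u - v) \<ge> 0)"

definition maximally_monotone :: "('a::real_inner \<Rightarrow> 'a set) \<Rightarrow> bool" where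
  "maximally_monotone A \<longleftrightarrow>
     monotone_op A \<and> (\<forall>B. monotone_op B \<and> (\<forall>x. A x \<subseteq> B x) \<longrightarrow> B = A)"

definition op_inverse :: "('a \<Rightarrow> 'a set) \<Rightarrow> 'a \<Rightarrow> 'a set" where
  "op_inverse A u = {x. u \<in> A x}"

definition id_plus_scaled :: "real \<Rightarrow> ('a::real_vector \<Rightarrow> 'a set) \<Rightarrow> 'a \<Rightarrow> 'a set" where
  "id_plus_scaled \<mu> A x = {x + \<mu> *\<^sub>R u | u. u \<in> A x}"

text \<open>The resolvent as a point-valued map. For \<open>\<mu> > 0\<close> and maximally monotone \<open>A\<close> the set below is
  a singleton at every point (Minty's theorem); otherwise the value may be unspecified.\<close>

definition resolvent :: "real \<Rightarrow> ('a::real_vector \<Rightarrow> 'a set) \<Rightarrow> 'a \<Rightarrow> 'a" where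
  "resolvent \<mu> A y = the_elem (op_inverse (id_plus_scaled \<mu> A) y)"

text \<open>Weak convergence in a Hilbert space, where the continuous linear functionals are exactly the
  maps \<open>\<lambda>z. inner z v\<close>.\<close>

definition weakly_converges :: "(nat \<Rightarrow> 'a::real_inner) \<Rightarrow> 'a \<Rightarrow> bool" where
  "weakly_converges X l \<longleftrightarrow> (\<forall>v. (\<lambda>k. inner (X k) v) \<longlonglongrightarrow> inner l v)"

end

theory Submission
  imports Defs
begin

text \<open>With \<open>\<xi>\<^sub>k = (y\<^sub>k - p\<^sub>k) / (\<lambda>\<^sub>k + s)\<close>, where \<open>p\<^sub>k\<close> is the resolvent
of index \<open>\<lambda>\<^sub>k + s\<close> at \<open>y\<^sub>k\<close>, the algorithm reads
\<open>x\<^sub>k\<^sub>+\<^sub>1 = y\<^sub>k - s \<xi>\<^sub>k\<close> with \<open>\<xi>\<^sub>k \<in> A (x\<^sub>k\<^sub>+\<^sub>1 - \<lambda>\<^sub>k \<xi>\<^sub>k)\<close>: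
an implicit step for the Yosida regularization of index \<open>\<lambda>\<^sub>k\<close>, which is
\<open>\<lambda>\<^sub>k\<close>-cocoercive. That the resolvent is everywhere defined is Minty's theorem
(\<open>minty_graph\<close>), obtained by minimizing the Fitzpatrick function plus half the squared norm.

\<^bold>\<open>Energy.\<close> Fix a zero \<open>z\<close> of \<open>A\<close>, put \<open>h\<^sub>k = \<parallel>x\<^sub>k - z\<parallel>\<^sup>2 / 2\<close> and
\<open>d\<^sub>k = x\<^sub>k - x\<^sub>k\<^sub>-\<^sub>1\<close>. Cocoercivity makes \<open>h\<close> satisfy a damped second order
inequality with the dissipation \<open>s \<lambda>\<^sub>k \<parallel>\<xi>\<^sub>k\<parallel>\<^sup>2\<close>. Since
\<open>s \<xi>\<^sub>k = (1 - \<alpha>/k) d\<^sub>k - d\<^sub>k\<^sub>+\<^sub>1\<close> and \<open>\<lambda>\<^sub>k\<close> grows like \<open>k\<^sup>2\<close>, the dissipation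
controls the kinetic term, and
\<open>(k-1)(h\<^sub>k - h\<^sub>k\<^sub>-\<^sub>1) + (\<alpha>-1) h\<^sub>k\<^sub>-\<^sub>1 + ((1+\<epsilon>)/\<alpha>) (k-1)\<^sup>2 \<parallel>d\<^sub>k\<parallel>\<^sup>2\<close>
is a Lyapunov function that loses at least a fixed positive multiple of
\<open>k \<parallel>d\<^sub>k\<parallel>\<^sup>2\<close> in each step with \<open>k \<ge> \<alpha>\<close>
(\<open>energy_decrease\<close>); the condition on \<open>\<epsilon>\<close> says
exactly that this multiple is positive. It also dominates a positive definite quadratic form in
\<open>(k-1) d\<^sub>k\<close> and \<open>x\<^sub>k\<^sub>-\<^sub>1 - z\<close> (\<open>energy_lower_bound\<close>). This gives the rate, the summability,
and the convergence of \<open>\<parallel>x\<^sub>k - z\<parallel>\<close>.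

\<^bold>\<open>Residual.\<close> The same inequality shows that \<open>\<parallel>\<lambda>\<^sub>k \<xi>\<^sub>k\<parallel>\<^sup>2 / k\<close> is summable, while
monotonicity of \<open>A\<close> bounds the increments of \<open>\<lambda>\<^sub>k \<xi>\<^sub>k\<close> by a multiple of \<open>1/k\<close>. A
Tauberian argument (\<open>null_of_log_integrable\<close>) turns this into \<open>\<lambda>\<^sub>k \<xi>\<^sub>k \<longlonglongrightarrow> 0\<close>, so
\<open>x\<^sub>k\<close> is asymptotically fixed by the resolvent of index 1.

\<^bold>\<open>Weak limit.\<close> Opial's argument is carried out with asymptotic centers instead of weak
cluster points (\<open>weak_convergence_to_fixed_point\<close>): the center of \<open>x\<close> along any filter
refining \<open>k \<rightarrow> \<infinity>\<close> is a fixed point of the resolvent,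
all these centers coincide because the distances to fixed points
converge, and their common value is the weak limit. The center and the
minimizer in Minty's theorem come from the same lemma \<open>epigraph_minimizer\<close>.\<close>

section \<open>Strongly convex minimization\<close>

text \<open>The set \<open>C\<close> plays the epigraph of a closed convex function \<open>g\<close>, and the lemma minimizes
\<open>g + \<parallel>\<cdot>\<parallel>\<^sup>2/2\<close>. Working with the epigraph allows \<open>g\<close> to be infinite without extended reals.
By the parallelogram identity minimizing sequences are Cauchy, so completeness alone provides the
minimizer; the quadratic growth in the conclusion carries the optimality condition.\<close>

lemma epigraph_minimizer:
  fixes C :: "('b::{real_inner, complete_space} \<times> real) set"
  assumes "convex C" and "closed C" and "C \<noteq> {}"
    and bdd: "\<And>p t. (p, t) \<in> C \<Longrightarrow> m \<le> t + (norm p)\<^sup>2 / 2"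
  obtains p0 t0 where "(p0, t0) \<in> C"
    and "\<And>p t. (p, t) \<in> C \<Longrightarrow>
           t0 + (norm p0)\<^sup>2 / 2 + (norm (p - p0))\<^sup>2 / 2 \<le> t + (norm p)\<^sup>2 / 2"
proof -
  define f :: "'b \<times> real \<Rightarrow> real" where "f = (\<lambda>(p, t). t + (norm p)\<^sup>2 / 2)"
  define I where "I = Inf (f ` C)"
  have below: "bdd_below (f ` C)"
    by (rule bdd_belowI[of _ m]) (use bdd in \<open>auto simp: f_def\<close>)
  have I_le: "I \<le> f c" if "c \<in> C" for c
    unfolding I_def using below that by (auto intro: cInf_lower)
  have mid: "I \<le> (1 - l) * f (p, t) + l * f (q, r) - l * (1 - l) / 2 * (norm (p - q))\<^sup>2"
    if "(p, t) \<in> C" "(q, r) \<in> C" "0 \<le> l" "l \<le> 1" for p t q r l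
  proof -
    have "(1 - l) *\<^sub>R (p, t) + l *\<^sub>R (q, r) \<in> C"
      using \<open>convex C\<close> that unfolding convex_alt by blast
    from I_le[OF this]
    have "I \<le> (1 - l) * t + l * r + (norm ((1 - l) *\<^sub>R p + l *\<^sub>R q))\<^sup>2 / 2"
      by (simp add: f_def)
    also have "(norm ((1 - l) *\<^sub>R p + l *\<^sub>R q))\<^sup>2 =
        (1 - l) * (norm p)\<^sup>2 + l * (norm q)\<^sup>2 - l * (1 - l) * (norm (p - q))\<^sup>2"
      unfolding power2_norm_eq_inner
      by (simp add: inner_add_left inner_add_right inner_diff_left inner_diff_right
          inner_commute[of q p]) algebra
    finally show ?thesis
      by (simp add: f_def field_simps)
  qed
  have "\<exists>c\<in>C. f c < I + inverse (real (Suc n))" for n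
  proof -
    have "Inf (f ` C) < I + inverse (real (Suc n))" by (simp add: I_def)
    then show ?thesis using cInf_less_iff[of "f ` C"] below \<open>C \<noteq> {}\<close> by auto
  qed
  then obtain c where cC: "\<And>n. c n \<in> C" and cf: "\<And>n. f (c n) < I + inverse (real (Suc n))"
    by metis
  define p where "p n = fst (c n)" for n
  define t where "t n = snd (c n)" for n
  have c_eq: "c n = (p n, t n)" for n by (simp add: p_def t_def)
  \<comment> \<open>Comparing two nearly optimal points with their midpoint bounds their distance.\<close>
  have dist_le: "(norm (p i - p j))\<^sup>2 \<le> 4 * (inverse (real (Suc i)) + inverse (real (Suc j)))" for i j
    using mid[of "p i" "t i" "p j" "t j" "1/2"] cC[of i] cC[of j] cf[of i] cf[of j]
    by (simp add: c_eq)
  have "Cauchy p"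
  proof (rule metric_CauchyI)
    fix e :: real assume "e > 0"
    obtain N where N: "inverse (real (Suc N)) < e\<^sup>2 / 8"
      using reals_Archimedean[of "e\<^sup>2 / 8"] \<open>e > 0\<close> by auto
    have "dist (p i) (p j) < e" if "i \<ge> N" "j \<ge> N" for i j
    proof -
      have "inverse (real (Suc i)) \<le> inverse (real (Suc N))" "inverse (real (Suc j)) \<le> inverse (real (Suc N))"
        using that by (auto intro!: le_imp_inverse_le)
      then have "(norm (p i - p j))\<^sup>2 < e\<^sup>2" using dist_le[of i j] N by argo
      then show ?thesis using \<open>e > 0\<close> by (auto simp: dist_norm intro: power_less_imp_less_base)
    qed
    then show "\<exists>M. \<forall>i\<ge>M. \<forall>j\<ge>M. dist (p i) (p j) < e" by blast
  qed
  then obtain p0 where p0: "p \<longlonglongrightarrow> p0" using Cauchy_convergent_iff convergent_def by blast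
  have "(\<lambda>n. f (c n)) \<longlonglongrightarrow> I"
  proof (rule tendsto_sandwich[of "\<lambda>_. I" _ _ "\<lambda>n. I + inverse (real (Suc n))"])
    show "(\<lambda>n. I + inverse (real (Suc n))) \<longlonglongrightarrow> I"
      using tendsto_add[OF tendsto_const LIMSEQ_inverse_real_of_nat, of I] by simp
  qed (use I_le[OF cC] cf in \<open>auto intro!: always_eventually less_imp_le simp del: of_nat_Suc\<close>)
  then have "(\<lambda>n. f (c n) - (norm (p n))\<^sup>2 / 2) \<longlonglongrightarrow> I - (norm p0)\<^sup>2 / 2"
    by (intro tendsto_intros p0) simp_all
  moreover have "f (c n) - (norm (p n))\<^sup>2 / 2 = t n" for n by (simp add: f_def c_eq)
  ultimately have "t \<longlonglongrightarrow> I - (norm p0)\<^sup>2 / 2" by simp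
  define t0 where "t0 = I - (norm p0)\<^sup>2 / 2"
  have "c \<longlonglongrightarrow> (p0, t0)"
    unfolding c_eq t0_def by (intro tendsto_Pair p0) fact
  then have in_C: "(p0, t0) \<in> C"
    using \<open>closed C\<close> cC closed_sequentially by blast
  have f0: "f (p0, t0) = I" by (simp add: f_def t0_def)
  show thesis
  proof (rule that[OF in_C])
    fix q r assume q: "(q, r) \<in> C"
    define D where "D = (norm (q - p0))\<^sup>2 / 2"
    \<comment> \<open>The minimum is compared with the values on the segment towards \<open>(q, r)\<close>; then \<open>l\<close> tends to 0.\<close>
    have "I + (1 - l) * D \<le> f (q, r)" if "0 < l" "l \<le> 1" for l
    proof -
      have "l * (I + (1 - l) * D) \<le> l * f (q, r)"
        using mid[OF in_C q, of l] that unfolding f0 D_def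
        by (simp add: norm_minus_commute algebra_simps)
      then show ?thesis using that by simp
    qed
    then have "eventually (\<lambda>l. I + (1 - l) * D \<le> f (q, r)) (at_right 0)"
      by (auto simp: eventually_at_right_field intro!: exI[of _ 1])
    moreover have "((\<lambda>l. I + (1 - l) * D) \<longlongrightarrow> I + (1 - 0) * D) (at_right 0)"
      by (intro tendsto_intros)
    ultimately have "I + (1 - 0) * D \<le> f (q, r)"
      by (intro tendsto_upperbound) auto
    then show "t0 + (norm p0)\<^sup>2 / 2 + (norm (q - p0))\<^sup>2 / 2 \<le> r + (norm q)\<^sup>2 / 2"
      by (simp add: f_def t0_def D_def)
  qed
qed

section \<open>Minty's theorem and resolvents\<close>

text \<open>Minty's theorem for a maximal monotone graph: \<open>0 \<in> x + G x\<close> for some \<open>x\<close>. The set \<open>C\<close> below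
is the epigraph of the Fitzpatrick function
\<open>F (x, w) = sup {\<langle>x, v\<rangle> + \<langle>u, w\<rangle> - \<langle>u, v\<rangle> | (u, v) \<in> G}\<close>, for which maximality gives
\<open>F (x, w) \<ge> \<langle>x, w\<rangle>\<close>. At the minimizer \<open>(x, w)\<close> of \<open>F + \<parallel>\<cdot>\<parallel>\<^sup>2/2\<close> the growth inequality, tested
on the graph, says that \<open>(-w, -x)\<close> is monotonically related to \<open>G\<close>, hence lies in \<open>G\<close>; tested once
more at this point it forces \<open>w = -x\<close>.\<close>

lemma minty_graph:
  fixes G :: "('a::{real_inner, complete_space} \<times> 'a) set"
  assumes mono: "\<And>u v u' v'. (u, v) \<in> G \<Longrightarrow> (u', v') \<in> G \<Longrightarrow> 0 \<le> inner (u - u') (v - v')"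
    and maxi: "\<And>x w. (\<And>u v. (u, v) \<in> G \<Longrightarrow> 0 \<le> inner (x - u) (w - v)) \<Longrightarrow> (x, w) \<in> G"
  obtains x where "(x, - x) \<in> G"
proof -
  define C :: "(('a \<times> 'a) \<times> real) set" where
    "C = (\<Inter>(u, v)\<in>G. {c. inner ((v, u), - 1) c \<le> inner u v})"
  have C_iff: "((x, w), t) \<in> C \<longleftrightarrow> (\<forall>(u, v)\<in>G. inner x v + inner u w - inner u v \<le> t)" for x w t
    by (auto simp: C_def inner_commute[of _ x] algebra_simps split: prod.splits)
  have fitz: "inner x w \<le> t" if "((x, w), t) \<in> C" for x w t
  proof (rule ccontr)
    assume less: "\<not> inner x w \<le> t"
    have bd: "inner x v + inner u w - inner u v \<le> t" if "(u, v) \<in> G" for u v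
      using \<open>((x, w), t) \<in> C\<close> that by (auto simp: C_iff)
    have "(x, w) \<in> G"
    proof (rule maxi)
      fix u v assume "(u, v) \<in> G"
      from bd[OF this] less show "0 \<le> inner (x - u) (w - v)" by (simp add: inner_simps)
    qed
    from bd[OF this] less show False by simp
  qed
  have graph_C: "((u, v), inner u v) \<in> C" if "(u, v) \<in> G" for u v
    using mono[OF that] by (auto simp: C_iff inner_simps) (smt (verit))
  have "convex C"
    unfolding C_def case_prod_unfold by (intro convex_INT convex_halfspace_le)
  moreover have "closed C"
    unfolding C_def case_prod_unfold by (intro closed_INT ballI closed_halfspace_le)
  moreover have "C \<noteq> {}"
  proof (cases "G = {}")
    case False
    then show ?thesis using graph_C by fastforce
  qed (auto simp: C_def)
  moreover have "0 \<le> t + (norm p)\<^sup>2 / 2" if "(p, t) \<in> C" for p t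
  proof -
    obtain x w where p: "p = (x, w)" by force
    have "0 \<le> inner (x + w) (x + w) / 2" by simp
    also have "\<dots> = inner x w + (norm p)\<^sup>2 / 2"
      by (simp add: p power2_norm_eq_inner inner_simps inner_commute[of w x] add_divide_distrib)
    finally have "0 \<le> inner x w + (norm p)\<^sup>2 / 2" .
    then show ?thesis using fitz[of x w t] that p by simp
  qed
  ultimately obtain p0 t0 where p0: "(p0, t0) \<in> C"
    and best: "\<And>p t. (p, t) \<in> C \<Longrightarrow>
           t0 + (norm p0)\<^sup>2 / 2 + (norm (p - p0))\<^sup>2 / 2 \<le> t + (norm p)\<^sup>2 / 2"
    by (rule epigraph_minimizer) blast+
  obtain x w where xw: "p0 = (x, w)" by force
  have related: "inner (x + w) (x + w) \<le> inner (u + w) (v + x)" if "(u, v) \<in> G" for u v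
    using best[OF graph_C[OF that]] fitz[OF p0[unfolded xw]]
    by (simp add: xw power2_norm_eq_inner inner_simps inner_commute[of w x] inner_commute[of x u]
        inner_commute[of x v] inner_commute[of w u] inner_commute[of w v]
        add_divide_distrib diff_divide_distrib)
  have "(- w, - x) \<in> G"
  proof (rule maxi)
    fix u v assume "(u, v) \<in> G"
    have "inner (- w - u) (- x - v) = inner (u + w) (v + x)"
      by (simp add: inner_simps)
    then show "0 \<le> inner (- w - u) (- x - v)"
      using related[OF \<open>(u, v) \<in> G\<close>] inner_ge_zero[of "x + w"] by argo
  qed
  moreover from related[OF this] have "x + w = 0"
    using inner_gt_zero_iff[of "x + w"] by fastforce
  then have "- w = x" by (simp add: add_eq_0_iff2)
  ultimately show thesis using that by simp
qed

text \<open>Otherwise adding the point \<open>(x, w)\<close> to the graph would extend \<open>A\<close> monotonically.\<close>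

lemma maximally_monotone_mem:
  assumes A: "maximally_monotone A"
    and related: "\<And>u v. v \<in> A u \<Longrightarrow> 0 \<le> inner (x - u) (w - v)"
  shows "w \<in> A x"
proof -
  define B where "B = A(x := insert w (A x))"
  have "monotone_op B"
    unfolding monotone_op_def
  proof (intro allI ballI)
    fix a b u v assume uv: "u \<in> B a" "v \<in> B b"
    have sym: "0 \<le> inner (a - x) (u - w)" if "u \<in> A a" for a u
      using related[OF that] inner_minus_left[of "x - a" "w - u"]
        inner_minus_right[of "- (x - a)" "w - u"] by simp
    have "0 \<le> inner (a - b) (u - v)" if "u \<in> A a" "v \<in> A b"
      using A that by (simp add: maximally_monotone_def monotone_op_def)
    then show "0 \<le> inner (a - b) (u - v)"
      using uv related sym by (auto simp: B_def split: if_splits)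
  qed
  moreover have "\<forall>z. A z \<subseteq> B z" by (auto simp: B_def)
  ultimately have "B = A" using A by (auto simp: maximally_monotone_def)
  then show ?thesis by (metis B_def fun_upd_same insertI1)
qed

lemma monotone_opD:
  "monotone_op A \<Longrightarrow> u \<in> A p \<Longrightarrow> v \<in> A q \<Longrightarrow> 0 \<le> inner (p - q) (u - v)"
  by (simp add: monotone_op_def)

lemma resolvent_eq:
  assumes A: "monotone_op A" and "\<mu> > 0" and u: "u \<in> A p"
  shows "resolvent \<mu> A (p + \<mu> *\<^sub>R u) = p"
proof -
  have "q = p" if q: "v \<in> A q" "p + \<mu> *\<^sub>R u = q + \<mu> *\<^sub>R v" for q v
  proof -
    have eq: "p - q = \<mu> *\<^sub>R (v - u)" using q(2) by (simp add: algebra_simps)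
    have "inner (p - q) (p - q) = - \<mu> * inner (p - q) (u - v)"
      by (subst (2) eq) (simp add: inner_simps algebra_simps)
    also have "\<dots> \<le> 0"
      using monotone_opD[OF A u q(1)] \<open>\<mu> > 0\<close> by simp
    finally show ?thesis using inner_gt_zero_iff[of "p - q"] by fastforce
  qed
  then have "op_inverse (id_plus_scaled \<mu> A) (p + \<mu> *\<^sub>R u) = {p}"
    using u by (auto simp: op_inverse_def id_plus_scaled_def)
  then show ?thesis by (simp add: resolvent_def)
qed

text \<open>Existence comes from Minty's theorem for the graph of \<open>p \<mapsto> \<mu> A p - y\<close>, which inherits maximal
monotonicity from \<open>A\<close>.\<close>

lemma resolvent_mem:
  fixes A :: "'a::{real_inner, complete_space} \<Rightarrow> 'a set"
  assumes A: "maximally_monotone A" and "\<mu> > 0"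
  shows "(1 / \<mu>) *\<^sub>R (y - resolvent \<mu> A y) \<in> A (resolvent \<mu> A y)"
proof -
  have mono: "monotone_op A" using A by (simp add: maximally_monotone_def)
  define G where "G = {(p, w). (1 / \<mu>) *\<^sub>R (w + y) \<in> A p}"
  obtain p where "(p, - p) \<in> G"
  proof (rule minty_graph[of G])
    fix u v u' v' assume "(u, v) \<in> G" "(u', v') \<in> G"
    then have "0 \<le> inner (u - u') ((1 / \<mu>) *\<^sub>R (v + y) - (1 / \<mu>) *\<^sub>R (v' + y))"
      by (auto simp: G_def intro: monotone_opD[OF mono])
    also have "\<dots> = inner (u - u') (v - v') / \<mu>"
      by (simp add: inner_simps add_divide_distrib diff_divide_distrib)
    finally show "0 \<le> inner (u - u') (v - v')"
      using \<open>\<mu> > 0\<close> by (simp add: zero_le_divide_iff)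
  next
    fix x w assume rel: "\<And>u v. (u, v) \<in> G \<Longrightarrow> 0 \<le> inner (x - u) (w - v)"
    have "(1 / \<mu>) *\<^sub>R (w + y) \<in> A x"
    proof (rule maximally_monotone_mem[OF A])
      fix u v assume "v \<in> A u"
      then have "(u, \<mu> *\<^sub>R v - y) \<in> G" using \<open>\<mu> > 0\<close> by (simp add: G_def)
      from rel[OF this] have "0 \<le> inner (x - u) (w - (\<mu> *\<^sub>R v - y)) / \<mu>"
        using \<open>\<mu> > 0\<close> by simp
      also have "\<dots> = inner (x - u) ((1 / \<mu>) *\<^sub>R (w + y) - v)"
        using \<open>\<mu> > 0\<close> by (simp add: inner_simps field_simps)
      finally show "0 \<le> inner (x - u) ((1 / \<mu>) *\<^sub>R (w + y) - v)" .
    qed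
    then show "(x, w) \<in> G" by (simp add: G_def)
  qed auto
  then have mem: "(1 / \<mu>) *\<^sub>R (y - p) \<in> A p" by (simp add: G_def)
  from resolvent_eq[OF mono \<open>\<mu> > 0\<close> this] \<open>\<mu> > 0\<close> have "resolvent \<mu> A y = p" by simp
  with mem show ?thesis by simp
qed

lemma resolvent_nonexpansive:
  fixes A :: "'a::{real_inner, complete_space} \<Rightarrow> 'a set"
  assumes A: "maximally_monotone A" and "\<mu> > 0"
  shows "norm (resolvent \<mu> A y - resolvent \<mu> A z) \<le> norm (y - z)"
proof -
  define p q where "p = resolvent \<mu> A y" and "q = resolvent \<mu> A z"
  have mono: "monotone_op A" using A by (simp add: maximally_monotone_def)
  have "0 \<le> inner (p - q) ((1 / \<mu>) *\<^sub>R (y - p) - (1 / \<mu>) *\<^sub>R (z - q))"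
    unfolding p_def q_def by (intro monotone_opD[OF mono] resolvent_mem[OF A \<open>\<mu> > 0\<close>])
  also have "\<dots> = inner (p - q) ((y - z) - (p - q)) / \<mu>"
    by (simp add: inner_simps add_divide_distrib diff_divide_distrib)
  finally have "inner (p - q) (p - q) \<le> inner (p - q) (y - z)"
    using \<open>\<mu> > 0\<close> by (simp add: zero_le_divide_iff inner_diff_right[of _ "y - z"])
  also have "\<dots> \<le> norm (p - q) * norm (y - z)" by (rule norm_cauchy_schwarz)
  finally have "norm (p - q) * norm (p - q) \<le> norm (p - q) * norm (y - z)"
    by (simp add: dot_square_norm power2_eq_square)
  then show ?thesis
    unfolding p_def[symmetric] q_def[symmetric]
    by (cases "p = q") (auto simp: mult_le_cancel_left)
qed

lemma resolvent_fixed_iff: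
  fixes A :: "'a::{real_inner, complete_space} \<Rightarrow> 'a set"
  assumes A: "maximally_monotone A" and "\<mu> > 0"
  shows "resolvent \<mu> A z = z \<longleftrightarrow> z \<in> op_inverse A 0"
proof
  assume "resolvent \<mu> A z = z"
  with resolvent_mem[OF assms, of z] show "z \<in> op_inverse A 0" by (simp add: op_inverse_def)
next
  assume "z \<in> op_inverse A 0"
  then show "resolvent \<mu> A z = z"
    using resolvent_eq[of A \<mu> 0 z] A \<open>\<mu> > 0\<close> by (simp add: op_inverse_def maximally_monotone_def)
qed

section \<open>Asymptotic centers and weak convergence\<close>

definition limsup_sqdist_le :: "nat filter \<Rightarrow> (nat \<Rightarrow> 'a::real_normed_vector) \<Rightarrow> 'a \<Rightarrow> real \<Rightarrow> bool" where
  "limsup_sqdist_le F X w \<rho> \<longleftrightarrow> (\<forall>e>0. \<forall>\<^sub>F k in F. (norm (X k - w))\<^sup>2 \<le> \<rho> + e)"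

text \<open>The asymptotic center minimizes \<open>w \<mapsto> limsup \<parallel>X\<^sub>k - w\<parallel>\<^sup>2\<close>. Since
\<open>\<parallel>X\<^sub>k - w\<parallel>\<^sup>2 - \<parallel>w\<parallel>\<^sup>2\<close> is affine in \<open>w\<close>, this function is a convex one plus \<open>\<parallel>w\<parallel>\<^sup>2\<close>, and
the minimization lemma yields the center together with quadratic growth. Arbitrary filters take the
place of subsequences.\<close>

lemma asymptotic_center:
  fixes X :: "nat \<Rightarrow> 'a::{real_inner, complete_space}"
  assumes "F \<noteq> bot" and bounded: "\<forall>\<^sub>F k in F. norm (X k) \<le> B"
  obtains u r where "limsup_sqdist_le F X u r"
    and "\<And>w \<rho>. limsup_sqdist_le F X w \<rho> \<Longrightarrow> r + (norm (w - u))\<^sup>2 \<le> \<rho>"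
proof -
  define C where "C = {(w, t). \<forall>e>0. \<forall>\<^sub>F k in F. inner (X k) (X k) - 2 * inner (X k) w \<le> 2 * t + e}"
  have expand: "(norm (X k - w))\<^sup>2 = inner (X k) (X k) - 2 * inner (X k) w + (norm w)\<^sup>2" for k w
    by (simp add: power2_norm_eq_inner inner_simps inner_commute[of w "X k"])
  have C_iff: "(w, t) \<in> C \<longleftrightarrow> limsup_sqdist_le F X w (2 * t + (norm w)\<^sup>2)" for w t
    by (simp add: C_def limsup_sqdist_le_def expand algebra_simps)
  have "convex C"
    unfolding convex_alt
  proof (intro ballI allI impI, elim conjE)
    fix c d :: "'a \<times> real" and l :: real assume cd: "c \<in> C" "d \<in> C" and l: "0 \<le> l" "l \<le> 1"
    obtain w t w' t' where c: "c = (w, t)" and d: "d = (w', t')" by force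
    have "\<forall>\<^sub>F k in F. inner (X k) (X k) - 2 * inner (X k) ((1 - l) *\<^sub>R w + l *\<^sub>R w')
        \<le> 2 * ((1 - l) * t + l * t') + e" if "e > 0" for e
    proof -
      have "\<forall>\<^sub>F k in F. inner (X k) (X k) - 2 * inner (X k) w \<le> 2 * t + e"
        and "\<forall>\<^sub>F k in F. inner (X k) (X k) - 2 * inner (X k) w' \<le> 2 * t' + e"
        using cd that by (auto simp: C_def c d)
      then show ?thesis
      proof eventually_elim
        case (elim k)
        have "(1 - l) * (inner (X k) (X k) - 2 * inner (X k) w) + l * (inner (X k) (X k) - 2 * inner (X k) w')
            \<le> (1 - l) * (2 * t + e) + l * (2 * t' + e)"
          using elim l by (intro add_mono mult_left_mono) auto
        then show ?case by (simp add: inner_simps algebra_simps)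
      qed
    qed
    then show "(1 - l) *\<^sub>R c + l *\<^sub>R d \<in> C" by (simp add: C_def c d)
  qed
  moreover have "closed C"
    unfolding closed_sequential_limits
  proof (intro allI impI, elim conjE)
    fix c l assume cC: "\<forall>n. c n \<in> C" and "c \<longlonglongrightarrow> l"
    obtain w t where l: "l = (w, t)" by force
    have lim: "(\<lambda>n. 2 * B * norm (fst (c n) - w) + 2 * snd (c n)) \<longlonglongrightarrow> 2 * B * norm (w - w) + 2 * t"
      using \<open>c \<longlonglongrightarrow> l\<close> tendsto_fst[of c l] tendsto_snd[of c l]
      by (intro tendsto_intros) (auto simp: l)
    have "\<forall>\<^sub>F k in F. inner (X k) (X k) - 2 * inner (X k) w \<le> 2 * t + e" if "e > 0" for e
    proof -
      have "\<forall>\<^sub>F n in sequentially. 2 * B * norm (fst (c n) - w) + 2 * snd (c n) < 2 * t + e / 2"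
        using lim that by (intro order_tendstoD(2)[OF lim]) auto
      then obtain n where n: "2 * B * norm (fst (c n) - w) + 2 * snd (c n) < 2 * t + e / 2"
        by (auto simp: eventually_sequentially)
      have "\<forall>\<^sub>F k in F. inner (X k) (X k) - 2 * inner (X k) (fst (c n)) \<le> 2 * snd (c n) + e / 2"
        using cC[rule_format, of n] that by (auto simp: C_def case_prod_unfold)
      with bounded show ?thesis
      proof eventually_elim
        case (elim k)
        have "inner (X k) (fst (c n) - w) \<le> norm (X k) * norm (fst (c n) - w)"
          by (rule norm_cauchy_schwarz)
        also have "\<dots> \<le> B * norm (fst (c n) - w)"
          using elim by (intro mult_right_mono) auto
        finally show ?case using elim n by (simp add: inner_simps)
      qed
    qed
    then show "l \<in> C" by (simp add: C_def l)
  qed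
  moreover have "(0, B\<^sup>2 / 2) \<in> C"
  proof -
    have "\<forall>\<^sub>F k in F. (norm (X k))\<^sup>2 \<le> B\<^sup>2 + e" if "e > 0" for e
      using bounded
    proof eventually_elim
      case (elim k)
      then show ?case using that power_mono[OF elim, of 2] by simp
    qed
    then show ?thesis by (simp add: C_iff limsup_sqdist_le_def)
  qed
  then have "C \<noteq> {}" by blast
  moreover have "0 \<le> t + (norm w)\<^sup>2 / 2" if "(w, t) \<in> C" for w t
  proof -
    have "0 \<le> 2 * t + (norm w)\<^sup>2 + e" if "e > 0" for e
    proof -
      have "\<forall>\<^sub>F k in F. (norm (X k - w))\<^sup>2 \<le> 2 * t + (norm w)\<^sup>2 + e"
        using \<open>(w, t) \<in> C\<close> that by (simp add: C_iff limsup_sqdist_le_def)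
      then obtain k where "(norm (X k - w))\<^sup>2 \<le> 2 * t + (norm w)\<^sup>2 + e"
        using eventually_happens[of _ F] \<open>F \<noteq> bot\<close> by blast
      then show ?thesis using zero_le_power2[of "norm (X k - w)"] by linarith
    qed
    then have "0 \<le> 2 * t + (norm w)\<^sup>2" by (rule field_le_epsilon)
    then show ?thesis by simp
  qed
  ultimately obtain u t0 where u: "(u, t0) \<in> C" and best: "\<And>w t. (w, t) \<in> C \<Longrightarrow>
      t0 + (norm u)\<^sup>2 / 2 + (norm (w - u))\<^sup>2 / 2 \<le> t + (norm w)\<^sup>2 / 2"
    by (rule epigraph_minimizer) blast+
  show thesis
  proof (rule that)
    show "limsup_sqdist_le F X u (2 * t0 + (norm u)\<^sup>2)" using u by (simp add: C_iff)
    fix w \<rho> assume "limsup_sqdist_le F X w \<rho>"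
    then have "(w, \<rho> / 2 - (norm w)\<^sup>2 / 2) \<in> C" by (simp add: C_iff)
    from best[OF this] show "2 * t0 + (norm u)\<^sup>2 + (norm (w - u))\<^sup>2 \<le> \<rho>"
      by (simp add: field_simps)
  qed
qed

text \<open>Opial's lemma combined with the demiclosedness principle. If \<open>u\<close> is the center of \<open>X\<close> along a
proper filter \<open>F\<close> refining \<open>k \<rightarrow> \<infinity>\<close>, then \<open>T u\<close>
is asymptotically no farther from \<open>X\<close> than \<open>u\<close> is, so \<open>T u = u\<close>.
Since distances to fixed points converge, their limits do not depend on \<open>F\<close>, and all centers agree with
one point \<open>u\<close>. If \<open>\<langle>X\<^sub>k - u, v\<rangle> \<ge> \<delta> > 0\<close> occurred infinitely often, then along the
corresponding filter \<open>u + v\<close> would violate the quadratic growth of the asymptotic radius at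
\<open>u\<close>.\<close>

lemma weak_convergence_to_fixed_point:
  fixes X :: "nat \<Rightarrow> 'a::{real_inner, complete_space}"
  assumes nonexp: "\<And>a b. norm (T a - T b) \<le> norm (a - b)"
    and fp: "T z0 = z0"
    and conv: "\<And>z. T z = z \<Longrightarrow> convergent (\<lambda>k. norm (X k - z))"
    and res: "(\<lambda>k. X k - T (X k)) \<longlonglongrightarrow> 0"
  obtains u where "T u = u" and "weakly_converges X u"
proof -
  obtain B0 where B0: "\<And>k. norm (norm (X k - z0)) \<le> B0"
    using convergent_imp_Bseq[OF conv[OF fp]] unfolding Bseq_def by blast
  define B where "B = B0 + norm z0"
  have B: "norm (X k) \<le> B" for k
    using B0[of k] norm_triangle_ineq[of "X k - z0" z0] by (simp add: B_def)
  define L where "L z = lim (\<lambda>k. (norm (X k - z))\<^sup>2)" for z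
  have L: "(\<lambda>k. (norm (X k - z))\<^sup>2) \<longlonglongrightarrow> L z" if "T z = z" for z
  proof -
    obtain l where "(\<lambda>k. norm (X k - z)) \<longlonglongrightarrow> l" using conv[OF \<open>T z = z\<close>] convergent_def by blast
    then have "(\<lambda>k. (norm (X k - z))\<^sup>2) \<longlonglongrightarrow> l\<^sup>2" by (rule tendsto_power)
    then show ?thesis unfolding L_def by (simp add: limI)
  qed
  have L_bound: "limsup_sqdist_le F X z (L z)" if "T z = z" "F \<le> sequentially" for F z
    unfolding limsup_sqdist_le_def
  proof (intro allI impI)
    fix e :: real assume "e > 0"
    have "\<forall>\<^sub>F k in sequentially. (norm (X k - z))\<^sup>2 < L z + e"
      using order_tendstoD(2)[OF L[OF that(1)]] \<open>e > 0\<close> by simp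
    then have "\<forall>\<^sub>F k in sequentially. (norm (X k - z))\<^sup>2 \<le> L z + e"
      by eventually_elim simp
    then show "\<forall>\<^sub>F k in F. (norm (X k - z))\<^sup>2 \<le> L z + e"
      using that(2) by (rule filter_leD[rotated])
  qed
  have center: "\<exists>u r. T u = u \<and> L u \<le> r \<and> (\<forall>w \<rho>. limsup_sqdist_le F X w \<rho> \<longrightarrow> r + (norm (w - u))\<^sup>2 \<le> \<rho>)"
    if F: "F \<noteq> bot" "F \<le> sequentially" for F
  proof -
    obtain u r where u: "limsup_sqdist_le F X u r"
      and best: "\<And>w \<rho>. limsup_sqdist_le F X w \<rho> \<Longrightarrow> r + (norm (w - u))\<^sup>2 \<le> \<rho>"
      using asymptotic_center[OF F(1), of X B] B by auto
    define M where "M = B + norm u"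
    have M: "norm (X k - u) \<le> M" for k
      using norm_triangle_ineq4[of "X k" u] B[of k] by (simp add: M_def)
    have "limsup_sqdist_le F X (T u) r"
      unfolding limsup_sqdist_le_def
    proof (intro allI impI)
      fix e :: real assume "e > 0"
      define g where "g k = norm (X k - T (X k))" for k
      have g0: "g \<longlonglongrightarrow> 0"
        using tendsto_norm[OF res] by (simp add: g_def[abs_def])
      have "(\<lambda>k. g k * g k + 2 * M * g k) \<longlonglongrightarrow> 0 * 0 + 2 * M * 0"
        by (intro tendsto_intros g0)
      then have "\<forall>\<^sub>F k in sequentially. g k * g k + 2 * M * g k < e / 2"
        using \<open>e > 0\<close> by (intro order_tendstoD(2)) auto
      then have "\<forall>\<^sub>F k in F. g k * g k + 2 * M * g k < e / 2"
        using F(2) by (rule filter_leD[rotated])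
      moreover have "\<forall>\<^sub>F k in F. (norm (X k - u))\<^sup>2 \<le> r + e / 2"
        using u \<open>e > 0\<close> by (auto simp: limsup_sqdist_le_def)
      ultimately show "\<forall>\<^sub>F k in F. (norm (X k - T u))\<^sup>2 \<le> r + e"
      proof eventually_elim
        case (elim k)
        have "norm (X k - T u) \<le> g k + norm (T (X k) - T u)"
          unfolding g_def using norm_triangle_ineq[of "X k - T (X k)" "T (X k) - T u"] by simp
        also have "\<dots> \<le> g k + norm (X k - u)" using nonexp by simp
        finally have "(norm (X k - T u))\<^sup>2 \<le> (g k + norm (X k - u))\<^sup>2"
          by (intro power_mono) auto
        also have "\<dots> = g k * g k + 2 * norm (X k - u) * g k + (norm (X k - u))\<^sup>2"
          by (simp add: power2_eq_square algebra_simps)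
        also have "2 * norm (X k - u) * g k \<le> 2 * M * g k"
          using M[of k] by (intro mult_right_mono) (auto simp: g_def)
        finally show ?case using elim by simp
      qed
    qed
    from best[OF this] have fixed: "T u = u" by simp
    have "L u \<le> r + e" if "e > 0" for e
    proof -
      have "((\<lambda>k. (norm (X k - u))\<^sup>2) \<longlongrightarrow> L u) F"
        using L[OF fixed] F(2) by (rule tendsto_mono[rotated])
      moreover have "\<forall>\<^sub>F k in F. (norm (X k - u))\<^sup>2 \<le> r + e"
        using u that by (auto simp: limsup_sqdist_le_def)
      ultimately show ?thesis using F(1) by (intro tendsto_upperbound)
    qed
    then have "L u \<le> r" by (rule field_le_epsilon)
    with fixed best show ?thesis by blast
  qed
  obtain u r where u: "T u = u" "L u \<le> r"
    and u_best: "\<And>w \<rho>. limsup_sqdist_le sequentially X w \<rho> \<Longrightarrow> r + (norm (w - u))\<^sup>2 \<le> \<rho>"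
    using center[of sequentially] by auto
  have growth: "L u + (norm (w - u))\<^sup>2 \<le> \<rho>"
    if F: "F \<noteq> bot" "F \<le> sequentially" and w: "limsup_sqdist_le F X w \<rho>" for F w \<rho>
  proof -
    obtain u' r' where u': "T u' = u'" "L u' \<le> r'"
      and best: "\<And>w \<rho>. limsup_sqdist_le F X w \<rho> \<Longrightarrow> r' + (norm (w - u'))\<^sup>2 \<le> \<rho>"
      using center[OF F] by auto
    have "L u' + (norm (u - u'))\<^sup>2 \<le> L u"
      using best[OF L_bound[OF u(1) F(2)]] u'(2) by linarith
    moreover have "L u + (norm (u' - u))\<^sup>2 \<le> L u'"
      using u_best[OF L_bound[OF u'(1)]] u(2) by force
    ultimately have "(norm (u - u'))\<^sup>2 \<le> 0"
      using zero_le_power2[of "norm (u' - u)"] by linarith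
    then have "u' = u" by simp
    with best[OF w] u'(2) show ?thesis by simp
  qed
  have half: "\<forall>\<^sub>F k in sequentially. inner (X k - u) v < \<delta>" if "\<delta> > 0" for v \<delta>
  proof (rule ccontr)
    assume neg: "\<not> ?thesis"
    define F where "F = inf sequentially (principal {k. \<delta> \<le> inner (X k - u) v})"
    have F: "F \<noteq> bot" "F \<le> sequentially"
      using neg by (auto simp: F_def trivial_limit_def eventually_inf_principal not_le
          elim: eventually_mono)
    have "limsup_sqdist_le F X (u + v) (L u - 2 * \<delta> + (norm v)\<^sup>2)"
      unfolding limsup_sqdist_le_def
    proof (intro allI impI)
      fix e :: real assume "e > 0"
      have "\<forall>\<^sub>F k in F. \<delta> \<le> inner (X k - u) v"
        by (simp add: F_def eventually_inf_principal)
      moreover have "\<forall>\<^sub>F k in F. (norm (X k - u))\<^sup>2 \<le> L u + e"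
        using L_bound[OF u(1) F(2)] \<open>e > 0\<close> by (simp add: limsup_sqdist_le_def)
      ultimately show "\<forall>\<^sub>F k in F. (norm (X k - (u + v)))\<^sup>2 \<le> L u - 2 * \<delta> + (norm v)\<^sup>2 + e"
      proof eventually_elim
        case (elim k)
        have "(norm (X k - (u + v)))\<^sup>2 = (norm (X k - u))\<^sup>2 - 2 * inner (X k - u) v + (norm v)\<^sup>2"
          by (simp add: power2_norm_eq_inner inner_simps inner_commute algebra_simps)
        then show ?case using elim by simp
      qed
    qed
    from growth[OF F this] \<open>\<delta> > 0\<close> show False by simp
  qed
  have "(\<lambda>k. inner (X k - u) v) \<longlonglongrightarrow> 0" for v
  proof (rule order_tendstoI)
    fix a :: real assume "a < 0"
    then show "\<forall>\<^sub>F k in sequentially. a < inner (X k - u) v"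
      using half[of "- a" "- v"] by simp
  qed (use half in auto)
  then have "weakly_converges X u"
    unfolding weakly_converges_def by (simp add: inner_diff_left LIM_zero_iff)
  with u(1) show thesis by (rule that)
qed

section \<open>Real sequences\<close>

text \<open>The sequence \<open>e\<close> acts as an energy: what is dissipated in total is at most the initial amount plus
the injected \<open>c\<close>.\<close>

lemma summable_of_drop:
  fixes e b c :: "nat \<Rightarrow> real"
  assumes drop: "\<And>k. k \<ge> K \<Longrightarrow> e (Suc k) + b k \<le> e k + c k"
    and low: "\<And>k. k \<ge> K \<Longrightarrow> L \<le> e k"
    and b0: "\<And>k. k \<ge> K \<Longrightarrow> 0 \<le> b k" and c0: "\<And>k. k \<ge> K \<Longrightarrow> 0 \<le> c k"
    and c: "summable c"
  shows "summable b"
proof -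
  have sc: "summable (\<lambda>k. c (k + K))" using c by (simp add: summable_iff_shift)
  have le: "(\<Sum>k<n. b (k + K)) + e (n + K) \<le> e K + (\<Sum>k<n. c (k + K))" for n
  proof (induction n)
    case (Suc n)
    then show ?case using drop[of "n + K"] by simp
  qed simp
  have "summable (\<lambda>k. b (k + K))"
  proof (rule summableI_nonneg_bounded)
    show "(\<Sum>k<n. b (k + K)) \<le> e K - L + (\<Sum>k. c (k + K))" for n
      using le[of n] low[of "n + K"] sum_le_suminf[OF sc, of "{..<n}"] c0 by auto
  qed (use b0 in auto)
  then show ?thesis by (simp add: summable_iff_shift)
qed

lemma convergent_of_summable_increase:
  fixes u c :: "nat \<Rightarrow> real"
  assumes c: "summable c" and le: "\<And>k. u (Suc k) \<le> u k + c k" and low: "\<And>k. L \<le> u k"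
    and c0: "\<And>k. 0 \<le> c k"
  shows "convergent u"
proof -
  define g where "g n = u n - (\<Sum>k<n. c k)" for n
  have "decseq g" by (rule decseq_SucI) (use le in \<open>simp add: g_def algebra_simps\<close>)
  moreover have "L - suminf c \<le> g n" for n
    using low[of n] sum_le_suminf[OF c, of "{..<n}"] c0 by (auto simp: g_def)
  ultimately obtain l where "g \<longlonglongrightarrow> l" using decseq_convergent by blast
  then have "(\<lambda>n. g n + (\<Sum>k<n. c k)) \<longlonglongrightarrow> l + suminf c"
    by (intro tendsto_intros summable_LIMSEQ c)
  then show ?thesis by (auto simp: g_def convergent_def)
qed

text \<open>In the time variable \<open>log k\<close> the hypotheses say that \<open>q\<^sup>2\<close> is integrable and \<open>q\<close> is Lipschitz.
The increments of \<open>q\<^sup>3\<close> are then dominated by those of \<open>\<integral> q\<^sup>2\<close>, so \<open>q\<close> converges, and a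
nonzero limit would contradict the divergence of the harmonic series.\<close>

lemma null_of_log_integrable:
  fixes q :: "nat \<Rightarrow> real"
  assumes q0: "\<And>k. 0 \<le> q k"
    and summ: "summable (\<lambda>k. (q k)\<^sup>2 / real k)"
    and lip: "\<forall>\<^sub>F k in sequentially. \<bar>q (Suc k) - q k\<bar> \<le> C / real k"
  shows "q \<longlonglongrightarrow> 0"
proof -
  have "summable (\<lambda>k. q (Suc k) ^ 3 - q k ^ 3)"
  proof (rule summable_comparison_test_ev)
    have "summable (\<lambda>k. 2 * C * (2 * ((q (Suc k))\<^sup>2 / real (Suc k)) + (q k)\<^sup>2 / real k))"
      using summ summable_Suc_iff[of "\<lambda>k. (q k)\<^sup>2 / real k"]
      by (intro summable_mult summable_add) auto
    then show "summable (\<lambda>k. 2 * C * (2 * ((q (Suc k))\<^sup>2 / real (Suc k)) + (q k)\<^sup>2 / real k))" .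
    show "\<forall>\<^sub>F k in sequentially. norm (q (Suc k) ^ 3 - q k ^ 3)
        \<le> 2 * C * (2 * ((q (Suc k))\<^sup>2 / real (Suc k)) + (q k)\<^sup>2 / real k)"
      using lip eventually_ge_at_top[of 1]
    proof eventually_elim
      case (elim k)
      define a b where "a = q (Suc k)" and "b = q k"
      have ab: "0 \<le> a" "0 \<le> b" using q0 by (auto simp: a_def b_def)
      have "0 \<le> C / real k" using elim by linarith
      then have C: "0 \<le> C" using elim(2) by (simp add: zero_le_divide_iff)
      have "a ^ 3 - b ^ 3 = (a - b) * (a\<^sup>2 + a * b + b\<^sup>2)"
        by (simp add: power2_eq_square power3_eq_cube algebra_simps)
      then have "\<bar>a ^ 3 - b ^ 3\<bar> = \<bar>a - b\<bar> * (a\<^sup>2 + a * b + b\<^sup>2)"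
        using ab by (simp add: abs_mult)
      also have "\<dots> \<le> C / real k * (2 * (a\<^sup>2 + b\<^sup>2))"
      proof (rule mult_mono)
        have "0 \<le> (a - b)\<^sup>2" by simp
        also have "\<dots> = a\<^sup>2 + b\<^sup>2 - 2 * (a * b)" by (simp add: power2_diff)
        finally show "a\<^sup>2 + a * b + b\<^sup>2 \<le> 2 * (a\<^sup>2 + b\<^sup>2)"
          using mult_nonneg_nonneg[OF ab] by argo
      qed (use elim ab \<open>0 \<le> C / real k\<close> in \<open>auto simp: a_def b_def\<close>)
      also have "\<dots> = 2 * C * (a\<^sup>2 / real k + b\<^sup>2 / real k)"
        by (simp add: add_divide_distrib distrib_left mult.assoc mult.left_commute[of C])
      also have "\<dots> \<le> 2 * C * (2 * (a\<^sup>2 / real (Suc k)) + b\<^sup>2 / real k)"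
      proof (intro mult_left_mono add_right_mono)
        have "a\<^sup>2 * real (Suc k) \<le> a\<^sup>2 * (2 * real k)"
          using elim(2) by (intro mult_left_mono) auto
        then show "a\<^sup>2 / real k \<le> 2 * (a\<^sup>2 / real (Suc k))"
          using elim(2) by (simp add: divide_simps mult.assoc) 
      qed (use C in auto)
      finally show ?case by (simp add: a_def b_def)
    qed
  qed
  then obtain l where "(\<lambda>n. \<Sum>k<n. q (Suc k) ^ 3 - q k ^ 3) \<longlonglongrightarrow> l"
    using summable_LIMSEQ by blast
  then have "(\<lambda>n. q n ^ 3 - q 0 ^ 3) \<longlonglongrightarrow> l" by (simp add: sum_lessThan_telescope[of "\<lambda>k. q k ^ 3"])
  then have "(\<lambda>n. q n ^ 3 - q 0 ^ 3 + q 0 ^ 3) \<longlonglongrightarrow> l + q 0 ^ 3" by (intro tendsto_intros)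
  then have "(\<lambda>n. root 3 (q n ^ 3)) \<longlonglongrightarrow> root 3 (l + q 0 ^ 3)"
    by (intro tendsto_intros) simp
  then obtain r where r: "q \<longlonglongrightarrow> r" using q0 by (auto simp: real_root_power_cancel)
  have "r = 0"
  proof (rule ccontr)
    assume "r \<noteq> 0"
    have "(\<lambda>k. (q k)\<^sup>2) \<longlonglongrightarrow> r\<^sup>2" by (intro tendsto_intros r)
    moreover have "r\<^sup>2 / 2 < r\<^sup>2" using \<open>r \<noteq> 0\<close> by simp
    ultimately have ev: "\<forall>\<^sub>F k in sequentially. r\<^sup>2 / 2 < (q k)\<^sup>2" by (rule order_tendstoD)
    have "summable (\<lambda>k. r\<^sup>2 / 2 * inverse (real k))"
    proof (rule summable_comparison_test_ev[OF _ summ])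
      show "\<forall>\<^sub>F k in sequentially. norm (r\<^sup>2 / 2 * inverse (real k)) \<le> (q k)\<^sup>2 / real k"
        using ev
      proof eventually_elim
        case (elim k)
        then have "r\<^sup>2 / 2 * inverse (real k) \<le> (q k)\<^sup>2 * inverse (real k)"
          by (intro mult_right_mono) auto
        then show ?case by (simp add: divide_inverse[of "(q k)\<^sup>2"])
      qed
    qed
    then have "summable (\<lambda>k. inverse (real k))" using \<open>r \<noteq> 0\<close> by (simp add: summable_cmult_iff)
    then show False using not_summable_harmonic[where 'a = real] by simp
  qed
  with r show ?thesis by simp
qed

section \<open>Energy estimates\<close>

text \<open>The algorithm with the resolvent eliminated: \<open>\<xi> k\<close> is the value at \<open>x (Suc k)\<close> of the Yosida
regularization of \<open>A\<close> of index \<open>lam k\<close>.\<close>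

locale regularized_inertial_proximal =
  fixes A :: "'a::real_inner \<Rightarrow> 'a set"
    and s \<alpha> \<epsilon> :: real
    and lam :: "nat \<Rightarrow> real"
    and x y \<xi> :: "nat \<Rightarrow> 'a"
  assumes mono: "monotone_op A"
    and s_pos: "s > 0"
    and alpha: "\<alpha> > 2"
    and eps: "\<epsilon> > 2 / (\<alpha> - 2)"
    and lam: "k \<ge> 1 \<Longrightarrow> lam k = (1 + \<epsilon>) * (s / \<alpha>\<^sup>2) * (real k)\<^sup>2"
    and y: "k \<ge> 1 \<Longrightarrow> y k = x k + (1 - \<alpha> / real k) *\<^sub>R (x k - x (k - 1))"
    and step: "k \<ge> 1 \<Longrightarrow> x (Suc k) = y k - s *\<^sub>R \<xi> k"
    and yosida: "k \<ge> 1 \<Longrightarrow> \<xi> k \<in> A (x (Suc k) - lam k *\<^sub>R \<xi> k)"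
begin

text \<open>In the comments \<open>d\<^sub>k\<close> stands for \<open>incr k\<close>.\<close>

definition incr :: "nat \<Rightarrow> 'a" where "incr k = x k - x (k - 1)"

definition half_sqdist :: "'a \<Rightarrow> nat \<Rightarrow> real" where "half_sqdist z k = (norm (x k - z))\<^sup>2 / 2"

text \<open>The weight of the kinetic term. It is the constant for which the dissipation
\<open>k s \<lambda>\<^sub>k \<parallel>\<xi>\<^sub>k\<parallel>\<^sup>2\<close> dominates a difference of weighted squared increments.\<close>

definition c :: real where "c = (1 + \<epsilon>) / \<alpha>"

definition energy :: "'a \<Rightarrow> nat \<Rightarrow> real" where
  "energy z k = (real k - 1) * (half_sqdist z k - half_sqdist z (k - 1)) + (\<alpha> - 1) * half_sqdist z (k - 1)
     + c * (real k - 1)\<^sup>2 * (norm (incr k))\<^sup>2"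

text \<open>This is the hypothesis on \<open>\<epsilon>\<close> rewritten; it is the only form in which it enters the decay and the
coercivity of the energy.\<close>

lemma c_gt: "c > 1 / (\<alpha> - 2)"
proof -
  have "\<alpha> < (1 + \<epsilon>) * (\<alpha> - 2)" using eps alpha by (simp add: field_simps)
  then show ?thesis using alpha by (simp add: c_def field_simps)
qed

lemma c_pos: "c > 0"
  using c_gt alpha by (smt (verit) zero_less_divide_iff)

lemma eps_pos: "1 + \<epsilon> > 0"
  using eps alpha by (smt (verit) zero_less_divide_iff)

lemma lam_pos: "k \<ge> 1 \<Longrightarrow> lam k > 0"
  using lam[of k] eps_pos s_pos alpha by simp

lemma cocoercive:
  assumes k: "k \<ge> 1" and z: "z \<in> op_inverse A 0"
  shows "lam k * (norm (\<xi> k))\<^sup>2 \<le> inner (x (Suc k) - z) (\<xi> k)"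
  using monotone_opD[OF mono yosida[OF k], of 0 z] z
  by (simp add: op_inverse_def inner_simps power2_norm_eq_inner)

text \<open>Expanding \<open>y\<^sub>k - z = (x\<^sub>k - z) + (1 - \<alpha>/k) d\<^sub>k\<close> gives the inertial terms, expanding
\<open>y\<^sub>k - z = (x\<^sub>k\<^sub>+\<^sub>1 - z) + s \<xi>\<^sub>k\<close> gives the dissipation through cocoercivity. The restriction
\<open>\<alpha> \<le> k\<close> keeps the extrapolation coefficient in \<open>[0, 1]\<close>.\<close>

lemma descent:
  assumes k: "k \<ge> 1" "\<alpha> \<le> real k" and z: "z \<in> op_inverse A 0"
  shows "half_sqdist z (Suc k) \<le> half_sqdist z k + (1 - \<alpha> / real k) * (half_sqdist z k - half_sqdist z (k - 1))
    + (norm (incr k))\<^sup>2 - s * lam k * (norm (\<xi> k))\<^sup>2"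
proof -
  define a where "a = 1 - \<alpha> / real k"
  have a: "0 \<le> a" "a \<le> 1" using k alpha by (auto simp: a_def field_simps)
  define w where "w = x k - z"
  have prev: "x (k - 1) - z = w - incr k" by (simp add: w_def incr_def)
  have yz: "y k - z = w + a *\<^sub>R incr k" using y[OF k(1)] by (simp add: w_def incr_def a_def)
  have "y k - z = (x (Suc k) - z) + s *\<^sub>R \<xi> k" using step[OF k(1)] by simp
  then have "(norm (y k - z))\<^sup>2 / 2
      = half_sqdist z (Suc k) + s * inner (x (Suc k) - z) (\<xi> k) + s * s * (norm (\<xi> k))\<^sup>2 / 2"
    by (simp add: half_sqdist_def power2_norm_eq_inner inner_simps inner_commute field_simps)
  moreover have "(norm (y k - z))\<^sup>2 / 2
      = half_sqdist z k + a * (half_sqdist z k - half_sqdist z (k - 1)) + (a + a\<^sup>2) / 2 * (norm (incr k))\<^sup>2"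
    unfolding yz half_sqdist_def prev w_def[symmetric] power2_norm_eq_inner
    by (simp add: inner_simps inner_commute field_simps power2_eq_square)
  moreover have "s * (lam k * (norm (\<xi> k))\<^sup>2) \<le> s * inner (x (Suc k) - z) (\<xi> k)"
    using cocoercive[OF k(1) z] s_pos by simp
  moreover have "(a + a\<^sup>2) / 2 * (norm (incr k))\<^sup>2 \<le> 1 * (norm (incr k))\<^sup>2"
    using a power_le_one[OF a, of 2] by (intro mult_right_mono) auto
  moreover have "0 \<le> s * s * (norm (\<xi> k))\<^sup>2 / 2" using s_pos by simp
  ultimately show ?thesis
    unfolding a_def[symmetric] mult.assoc by linarith
qed

lemma descent_scaled:
  assumes k: "k \<ge> 1" "\<alpha> \<le> real k" and z: "z \<in> op_inverse A 0"
  shows "real k * (half_sqdist z (Suc k) - half_sqdist z k) + real k * (s * lam k * (norm (\<xi> k))\<^sup>2)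
    \<le> (real k - \<alpha>) * (half_sqdist z k - half_sqdist z (k - 1)) + real k * (norm (incr k))\<^sup>2"
proof -
  have "real k * half_sqdist z (Suc k)
      \<le> real k * (half_sqdist z k + (1 - \<alpha> / real k) * (half_sqdist z k - half_sqdist z (k - 1))
    + (norm (incr k))\<^sup>2 - s * lam k * (norm (\<xi> k))\<^sup>2)"
    using descent[OF assms] by (intro mult_left_mono) auto
  also have "\<dots> = real k * half_sqdist z k
      + (real k * (1 - \<alpha> / real k)) * (half_sqdist z k - half_sqdist z (k - 1))
    + real k * (norm (incr k))\<^sup>2 - real k * (s * lam k * (norm (\<xi> k))\<^sup>2)"
    by (simp only: ring_distribs mult.assoc)
  also have "real k * (1 - \<alpha> / real k) = real k - \<alpha>" using k by (simp add: field_simps)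
  finally show ?thesis by (simp add: algebra_simps)
qed

text \<open>With \<open>a = 1 - \<alpha>/k\<close> one has \<open>s \<xi>\<^sub>k = a d\<^sub>k - d\<^sub>k\<^sub>+\<^sub>1\<close>, and convexity gives
\<open>\<parallel>a d\<^sub>k - d\<^sub>k\<^sub>+\<^sub>1\<parallel>\<^sup>2 \<ge> (1-a) \<parallel>d\<^sub>k\<^sub>+\<^sub>1\<parallel>\<^sup>2 - a (1-a) \<parallel>d\<^sub>k\<parallel>\<^sup>2\<close>. The gain \<open>1 - a\<close> is of order
\<open>1/k\<close>, which the growth \<open>\<lambda>\<^sub>k \<sim> k\<^sup>2\<close> and the additional factor \<open>k\<close> raise to order \<open>k\<^sup>2\<close>.\<close>

lemma dissipation_bound:
  assumes k: "k \<ge> 1" "\<alpha> \<le> real k"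
  shows "c * (real k)\<^sup>2 * (norm (incr (Suc k)))\<^sup>2 - c * (real k * (real k - \<alpha>)) * (norm (incr k))\<^sup>2
    \<le> real k * (s * lam k * (norm (\<xi> k))\<^sup>2)"
proof -
  define a where "a = 1 - \<alpha> / real k"
  have a: "0 \<le> a" "a \<le> 1" using k alpha by (auto simp: a_def field_simps)
  have "s *\<^sub>R \<xi> k = a *\<^sub>R incr k - incr (Suc k)"
    using step[OF k(1)] y[OF k(1)] by (simp add: incr_def a_def)
  then have "s\<^sup>2 * (norm (\<xi> k))\<^sup>2 = (norm (a *\<^sub>R incr k - incr (Suc k)))\<^sup>2"
    by (metis norm_scaleR power2_abs power_mult_distrib)
  also have "\<dots> = (1 - a) * (norm (incr (Suc k)))\<^sup>2 + a * (norm (incr (Suc k) - incr k))\<^sup>2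
      - a * (1 - a) * (norm (incr k))\<^sup>2"
    by (simp add: power2_norm_eq_inner inner_simps inner_commute algebra_simps)
  also have "\<dots> \<ge> (1 - a) * (norm (incr (Suc k)))\<^sup>2 - a * (1 - a) * (norm (incr k))\<^sup>2"
    using a by simp
  finally have le: "(1 - a) * (norm (incr (Suc k)))\<^sup>2 - a * (1 - a) * (norm (incr k))\<^sup>2
      \<le> s\<^sup>2 * (norm (\<xi> k))\<^sup>2" .
  define m where "m = (1 + \<epsilon>) / \<alpha>\<^sup>2 * (real k) ^ 3"
  have "m \<ge> 0" using eps_pos by (simp add: m_def)
  have kpos: "real k > 0" using k by simp
  have a1: "1 - a = \<alpha> / real k" by (simp add: a_def)
  have m1: "m * (1 - a) = c * (real k)\<^sup>2"
    using kpos alpha by (simp add: a1 m_def c_def power2_eq_square power3_eq_cube)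
  have m2: "m * (a * (1 - a)) = c * (real k * (real k - \<alpha>))"
  proof -
    have "m * (a * (1 - a)) = (m * (1 - a)) * a" by simp
    also have "\<dots> = c * real k * (real k * a)" by (simp add: m1 power2_eq_square)
    also have "real k * a = real k - \<alpha>" using kpos by (simp add: a_def field_simps)
    finally show ?thesis by simp
  qed
  have m3: "m * s\<^sup>2 = real k * (s * lam k)"
    by (simp add: lam[OF k(1)] m_def power2_eq_square power3_eq_cube)
  have "(m * (1 - a)) * (norm (incr (Suc k)))\<^sup>2 - (m * (a * (1 - a))) * (norm (incr k))\<^sup>2
      \<le> (m * s\<^sup>2) * (norm (\<xi> k))\<^sup>2"
  proof -
    have distr: "m * (p * M - q * N) = m * p * M - m * q * N" for p q M N :: real
      by (simp add: algebra_simps)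
    show ?thesis
      using mult_left_mono[OF le \<open>m \<ge> 0\<close>] unfolding distr by (simp only: mult.assoc)
  qed
  then show ?thesis by (simp only: m1 m2 m3 mult.assoc)
qed

text \<open>Adding the two preceding estimates, the coefficient of \<open>c \<parallel>d\<^sub>k\<parallel>\<^sup>2\<close> is
\<open>k\<^sup>2 - \<alpha> k - (k-1)\<^sup>2 = - (\<alpha> - 2) k - 1\<close>, which outweighs the term
\<open>k \<parallel>d\<^sub>k\<parallel>\<^sup>2\<close> from the extrapolation because \<open>c (\<alpha> - 2) > 1\<close>.\<close>

lemma energy_decrease:
  assumes k: "k \<ge> 1" "\<alpha> \<le> real k" and z: "z \<in> op_inverse A 0"
  shows "energy z (Suc k) + (c * (\<alpha> - 2) - 1) * (real k * (norm (incr k))\<^sup>2) \<le> energy z k"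
proof -
  have "0 \<le> c * (norm (incr k))\<^sup>2" using c_pos by simp
  then show ?thesis
    using descent_scaled[OF assms] dissipation_bound[OF k]
    by (simp add: energy_def power2_eq_square algebra_simps)
qed

text \<open>For \<open>v = (k-1) d\<^sub>k\<close>, \<open>w = x\<^sub>k\<^sub>-\<^sub>1 - z\<close> and \<open>b = \<alpha> - 1\<close> the energy is at least
\<open>c \<parallel>v\<parallel>\<^sup>2 + \<langle>v, w\<rangle> + b/2 \<parallel>w\<parallel>\<^sup>2\<close>, where \<open>c > 1/b\<close>, so the form is definite with room to
spare.\<close>

lemma energy_lower_bound:
  assumes "k \<ge> 1"
  shows "(norm ((real k - 1) *\<^sub>R incr k))\<^sup>2 / (3 * (\<alpha> - 1)) + (\<alpha> - 1) / 8 * (norm (x (k - 1) - z))\<^sup>2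
    \<le> energy z k"
proof -
  define b where "b = \<alpha> - 1"
  have b: "b > 1" using alpha by (simp add: b_def)
  define v w where "v = (real k - 1) *\<^sub>R incr k" and "w = x (k - 1) - z"
  have xk: "x k - z = w + incr k" by (simp add: w_def incr_def)
  have hw: "half_sqdist z (k - 1) = (norm w)\<^sup>2 / 2" by (simp add: half_sqdist_def w_def)
  have "(real k - 1) * (half_sqdist z k - half_sqdist z (k - 1)) = inner v w + (real k - 1) / 2 * (norm (incr k))\<^sup>2"
    unfolding hw unfolding half_sqdist_def xk
    by (simp add: v_def power2_norm_eq_inner inner_simps inner_commute field_simps)
  moreover have "(real k - 1)\<^sup>2 * (norm (incr k))\<^sup>2 = (norm v)\<^sup>2"
    by (simp add: v_def power_mult_distrib)
  ultimately have "energy z k = inner v w + (real k - 1) / 2 * (norm (incr k))\<^sup>2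
      + b * ((norm w)\<^sup>2 / 2) + c * (norm v)\<^sup>2"
    by (simp only: energy_def b_def hw mult.assoc)
  moreover have "0 \<le> (real k - 1) / 2 * (norm (incr k))\<^sup>2" using assms by simp
  ultimately have "inner v w + b / 2 * (norm w)\<^sup>2 + c * (norm v)\<^sup>2 \<le> energy z k"
    by simp
  moreover have "1 / b * (norm v)\<^sup>2 \<le> c * (norm v)\<^sup>2"
  proof (rule mult_right_mono)
    have "1 / b \<le> 1 / (\<alpha> - 2)" using alpha by (simp add: b_def frac_le)
    then show "1 / b \<le> c" using c_gt by simp
  qed simp
  \<comment> \<open>Young's inequality; the weights leave a positive share of both squares.\<close>
  moreover have "- (2 / (3 * b) * (norm v)\<^sup>2 + 3 * b / 8 * (norm w)\<^sup>2) \<le> inner v w"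
  proof -
    have "0 \<le> (norm (4 *\<^sub>R v + (3 * b) *\<^sub>R w))\<^sup>2 / (24 * b)" using b by simp
    also have "\<dots> = 2 / (3 * b) * (norm v)\<^sup>2 + inner v w + 3 * b / 8 * (norm w)\<^sup>2"
      using b by (simp add: power2_norm_eq_inner inner_simps inner_commute[of w v] field_simps)
    finally show ?thesis by simp
  qed
  moreover have "1 / b * (norm v)\<^sup>2 = 2 / (3 * b) * (norm v)\<^sup>2 + (norm v)\<^sup>2 / (3 * b)"
    using b by (simp add: field_simps)
  ultimately have "(norm v)\<^sup>2 / (3 * b) + b / 8 * (norm w)\<^sup>2 \<le> energy z k" by argo
  then show ?thesis by (simp add: v_def w_def b_def)
qed

lemma energy_nonneg: "k \<ge> 1 \<Longrightarrow> 0 \<le> energy z k"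
  using energy_lower_bound[of k z] alpha
  by (smt (verit) divide_nonneg_pos mult_nonneg_nonneg zero_le_power2)

text \<open>From this index on \<open>0 \<le> 1 - \<alpha>/k \<le> 1\<close>.\<close>

definition K :: nat where "K = nat \<lceil>\<alpha>\<rceil>"

lemma K: "k \<ge> K \<Longrightarrow> \<alpha> \<le> real k" "k \<ge> K \<Longrightarrow> k \<ge> 1"
proof -
  have K_ge: "\<alpha> \<le> real K" unfolding K_def by (rule real_nat_ceiling_ge)
  show "\<alpha> \<le> real k" if "k \<ge> K" using that K_ge by (meson of_nat_le_iff order_trans)
  then show "k \<ge> 1" if "k \<ge> K" using that alpha by fastforce
qed

lemma summable_velocity:
  assumes z: "z \<in> op_inverse A 0"
  shows "summable (\<lambda>k. real k * (norm (incr k))\<^sup>2)"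
proof -
  define D where "D = c * (\<alpha> - 2) - 1"
  have "D > 0" using c_gt alpha by (simp add: D_def field_simps)
  have "summable (\<lambda>k. D * (real k * (norm (incr k))\<^sup>2))"
  proof (rule summable_of_drop[where K = K])
    show "energy z (Suc k) + D * (real k * (norm (incr k))\<^sup>2) \<le> energy z k + 0" if "k \<ge> K" for k
      using energy_decrease[OF K(2)[OF that] K(1)[OF that] z] by (simp add: D_def)
  qed (use K \<open>D > 0\<close> energy_nonneg in auto)
  then show ?thesis using \<open>D > 0\<close> by (simp add: summable_cmult_iff)
qed

lemma velocity_bound:
  assumes z: "z \<in> op_inverse A 0"
  obtains M where "\<And>k. k \<ge> K \<Longrightarrow> real k * norm (incr (Suc k)) \<le> M"
proof -
  have anti: "energy z (K + n) \<le> energy z K" for n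
  proof (induction n)
    case (Suc n)
    have "0 \<le> (c * (\<alpha> - 2) - 1) * (real (K + n) * (norm (incr (K + n)))\<^sup>2)"
      using c_gt alpha by (intro mult_nonneg_nonneg) (auto simp: field_simps)
    then show ?case using Suc energy_decrease[OF K(2) K(1) z, of "K + n"] by simp
  qed simp
  define M where "M = sqrt (3 * (\<alpha> - 1) * energy z K)"
  have "real k * norm (incr (Suc k)) \<le> M" if "k \<ge> K" for k
  proof -
    have "(norm ((real (Suc k) - 1) *\<^sub>R incr (Suc k)))\<^sup>2 / (3 * (\<alpha> - 1)) \<le> energy z (Suc k)"
      using energy_lower_bound[of "Suc k" z] alpha
      by (smt (verit) One_nat_def Suc_le_mono le0 divide_nonneg_pos mult_nonneg_nonneg zero_le_power2)
    also have "\<dots> \<le> energy z K" using anti[of "Suc k - K"] that by simp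
    finally have "(real k * norm (incr (Suc k)))\<^sup>2 \<le> 3 * (\<alpha> - 1) * energy z K"
      using alpha by (simp add: field_simps)
    then show ?thesis unfolding M_def by (rule real_le_rsqrt)
  qed
  then show thesis by (rule that)
qed

text \<open>The positive parts \<open>P\<^sub>k\<close> of \<open>h\<^sub>k - h\<^sub>k\<^sub>-\<^sub>1\<close>, where \<open>h\<^sub>k = half_sqdist z k\<close>, satisfy
\<open>k P\<^sub>k\<^sub>+\<^sub>1 + (\<alpha> - 1) P\<^sub>k \<le> (k - 1) P\<^sub>k + k \<parallel>d\<^sub>k\<parallel>\<^sup>2\<close> with a summable last term. They are
therefore summable, and a nonnegative sequence with summable increases converges.\<close>

lemma distance_convergent:
  assumes z: "z \<in> op_inverse A 0"
  shows "convergent (\<lambda>k. norm (x k - z))"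
proof -
  define P where "P k = max 0 (half_sqdist z k - half_sqdist z (k - 1))" for k
  have "summable (\<lambda>k. (\<alpha> - 1) * P k)"
  proof (rule summable_of_drop[where K = K and L = 0])
    show "real (Suc k - 1) * P (Suc k) + (\<alpha> - 1) * P k
        \<le> real (k - 1) * P k + real k * (norm (incr k))\<^sup>2" if "k \<ge> K" for k
    proof -
      have "real k * (half_sqdist z (Suc k) - half_sqdist z k) \<le>
          (real k - \<alpha>) * (half_sqdist z k - half_sqdist z (k - 1)) + real k * (norm (incr k))\<^sup>2"
        using descent_scaled[OF K(2)[OF that] K(1)[OF that] z] s_pos lam_pos[OF K(2)[OF that]]
        by (smt (verit) mult_nonneg_nonneg of_nat_0_le_iff zero_le_power2)
      also have "\<dots> \<le> (real k - \<alpha>) * P k + real k * (norm (incr k))\<^sup>2"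
        using K(1)[OF that] by (intro add_right_mono mult_left_mono) (auto simp: P_def)
      finally have "real k * (half_sqdist z (Suc k) - half_sqdist z k)
          \<le> (real k - \<alpha>) * P k + real k * (norm (incr k))\<^sup>2" .
      moreover have "0 \<le> (real k - \<alpha>) * P k + real k * (norm (incr k))\<^sup>2"
        using K(1)[OF that] by (auto simp: P_def)
      ultimately have "real k * P (Suc k) \<le> (real k - \<alpha>) * P k + real k * (norm (incr k))\<^sup>2"
        by (auto simp: P_def max_def)
      then show ?thesis using K(2)[OF that] by (simp add: of_nat_diff algebra_simps)
    qed
    show "summable (\<lambda>k. real k * (norm (incr k))\<^sup>2)" by (rule summable_velocity[OF z])
  qed (use alpha in \<open>auto simp: P_def\<close>)
  then have "summable P" using alpha by (simp add: summable_cmult_iff)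
  then have "summable (\<lambda>k. P (Suc k))" by (simp add: summable_Suc_iff)
  then have "convergent (half_sqdist z)"
    by (rule convergent_of_summable_increase[where L = 0]) (auto simp: P_def half_sqdist_def max_def)
  then obtain l where "half_sqdist z \<longlonglongrightarrow> l" by (auto simp: convergent_def)
  then have "(\<lambda>k. sqrt (2 * half_sqdist z k)) \<longlonglongrightarrow> sqrt (2 * l)" by (intro tendsto_intros)
  then show ?thesis by (auto simp: half_sqdist_def convergent_def)
qed

text \<open>Here the dissipation is kept instead of being traded for kinetic energy. The remaining part of the
energy is bounded below because \<open>k d\<^sub>k\<^sub>+\<^sub>1\<close> is bounded, and
\<open>k s \<lambda>\<^sub>k \<parallel>\<xi>\<^sub>k\<parallel>\<^sup>2\<close> is a constant multiple of \<open>\<parallel>\<lambda>\<^sub>k \<xi>\<^sub>k\<parallel>\<^sup>2 / k\<close>.\<close>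

lemma summable_regularization:
  assumes z: "z \<in> op_inverse A 0"
  shows "summable (\<lambda>k. (norm (lam k *\<^sub>R \<xi> k))\<^sup>2 / real k)"
proof -
  obtain M where M: "\<And>k. k \<ge> K \<Longrightarrow> real k * norm (incr (Suc k)) \<le> M"
    using velocity_bound[OF z] by blast
  define e where "e k = real (k - 1) * (half_sqdist z k - half_sqdist z (k - 1))
      + (\<alpha> - 1) * half_sqdist z (k - 1)" for k
  have "summable (\<lambda>k. real k * (s * lam k * (norm (\<xi> k))\<^sup>2))"
  proof (rule summable_of_drop[where K = "Suc K"])
    show "e (Suc k) + real k * (s * lam k * (norm (\<xi> k))\<^sup>2) \<le> e k + real k * (norm (incr k))\<^sup>2"
      if "k \<ge> Suc K" for k
      using descent_scaled[OF K(2) K(1) z, of k] that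
      by (simp add: e_def of_nat_diff algebra_simps)
    show "- c * M\<^sup>2 \<le> e k" if "k \<ge> Suc K" for k
    proof -
      obtain j where j: "k = Suc j" "j \<ge> K" using \<open>k \<ge> Suc K\<close> by (cases k) auto
      have "c * (real j * norm (incr k))\<^sup>2 \<le> c * M\<^sup>2"
        using M[OF j(2)] c_pos by (auto simp: j(1) intro!: mult_left_mono power_mono)
      then show ?thesis
        using energy_nonneg[of k z] j(1) by (simp add: energy_def e_def power_mult_distrib mult.assoc)
    qed
    show "summable (\<lambda>k. real k * (norm (incr k))\<^sup>2)" by (rule summable_velocity[OF z])
    show "0 \<le> real k * (s * lam k * (norm (\<xi> k))\<^sup>2)" if "k \<ge> Suc K" for k
      using s_pos lam_pos[of k] that by simp
  qed auto
  moreover have "real k * (s * lam k * (norm (\<xi> k))\<^sup>2)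
      = \<alpha>\<^sup>2 / (1 + \<epsilon>) * ((norm (lam k *\<^sub>R \<xi> k))\<^sup>2 / real k)" for k
  proof (cases "k = 0")
    case False
    then have l: "lam k = (1 + \<epsilon>) * (s / \<alpha>\<^sup>2) * (real k)\<^sup>2" using lam[of k] by simp
    have "real k * s = \<alpha>\<^sup>2 / (1 + \<epsilon>) * (lam k / real k)"
      using False eps_pos alpha by (simp add: l power2_eq_square)
    then have "real k * (s * lam k * (norm (\<xi> k))\<^sup>2)
        = \<alpha>\<^sup>2 / (1 + \<epsilon>) * (lam k / real k) * (lam k * (norm (\<xi> k))\<^sup>2)"
      by (metis mult.assoc)
    then show ?thesis by (simp add: power_mult_distrib power2_eq_square)
  qed simp
  ultimately have "summable (\<lambda>k. \<alpha>\<^sup>2 / (1 + \<epsilon>) * ((norm (lam k *\<^sub>R \<xi> k))\<^sup>2 / real k))"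
    by (simp only:)
  then show ?thesis
    using eps_pos alpha unfolding summable_cmult_iff by simp
qed

lemma regularization_le:
  assumes k: "k \<ge> 1" and z: "z \<in> op_inverse A 0"
  shows "norm (lam k *\<^sub>R \<xi> k) \<le> norm (x (Suc k) - z)"
proof -
  have "norm (\<xi> k) * (lam k * norm (\<xi> k)) \<le> norm (\<xi> k) * norm (x (Suc k) - z)"
    using cocoercive[OF k z] norm_cauchy_schwarz[of "x (Suc k) - z" "\<xi> k"]
    by (simp add: power2_eq_square algebra_simps)
  then show ?thesis using lam_pos[OF k]
    by (cases "\<xi> k = 0") (auto simp: mult_le_cancel_left)
qed

text \<open>The points \<open>x\<^sub>k\<^sub>+\<^sub>1 - \<lambda>\<^sub>k \<xi>\<^sub>k\<close> are resolvents of index \<open>\<lambda>\<^sub>k\<close> at \<open>x\<^sub>k\<^sub>+\<^sub>1\<close>. Monotonicity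
applied to two consecutive ones bounds their distance \<open>D\<close> by the change of the argument plus the
effect of the change of index, whose relative size \<open>\<lambda>\<^sub>k\<^sub>+\<^sub>1/\<lambda>\<^sub>k - 1 = (2k+1)/k\<^sup>2\<close> is at most
\<open>3/k\<close>.\<close>

lemma regularization_increment:
  assumes k: "k \<ge> 1"
  shows "norm (lam (Suc k) *\<^sub>R \<xi> (Suc k) - lam k *\<^sub>R \<xi> k)
    \<le> 2 * norm (incr (Suc (Suc k))) + 3 / real k * norm (lam k *\<^sub>R \<xi> k)"
proof -
  define r r' where "r = lam k *\<^sub>R \<xi> k" and "r' = lam (Suc k) *\<^sub>R \<xi> (Suc k)"
  define D where "D = (x (Suc (Suc k)) - r') - (x (Suc k) - r)"
  define t where "t = lam (Suc k) / lam k - 1"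
  have lp: "lam k > 0" "lam (Suc k) > 0" using lam_pos[of k] lam_pos[of "Suc k"] k by auto
  have D_eq: "r' - r = incr (Suc (Suc k)) - D" by (simp add: D_def incr_def)
  have t_eq: "t = (2 * real k + 1) / (real k)\<^sup>2"
  proof -
    have "lam (Suc k) / lam k = (real (Suc k))\<^sup>2 / (real k)\<^sup>2"
      using lam[of k] lam[of "Suc k"] k eps_pos s_pos alpha by simp
    then show ?thesis using k by (simp add: t_def field_simps power2_eq_square)
  qed
  have t: "0 \<le> t" "t \<le> 3 / real k"
    using k by (auto simp: t_eq field_simps power2_eq_square)
  have "0 \<le> inner D (\<xi> (Suc k) - \<xi> k)"
    unfolding D_def r_def r'_def using k by (intro monotone_opD[OF mono] yosida) auto
  then have "0 \<le> lam (Suc k) * inner D (\<xi> (Suc k) - \<xi> k)" using lp by simp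
  also have "\<dots> = inner D (lam (Suc k) *\<^sub>R \<xi> (Suc k) - (lam (Suc k) / lam k) *\<^sub>R lam k *\<^sub>R \<xi> k)"
    using lp by (simp add: inner_simps algebra_simps)
  also have "\<dots> = inner D (incr (Suc (Suc k)) - t *\<^sub>R r) - inner D D"
    using arg_cong[OF D_eq, of "inner D"]
    unfolding r_def[symmetric] r'_def[symmetric] by (simp add: t_def inner_simps algebra_simps)
  finally have "norm D * norm D \<le> inner D (incr (Suc (Suc k)) - t *\<^sub>R r)"
    by (simp add: dot_square_norm power2_eq_square)
  also have "\<dots> \<le> norm D * norm (incr (Suc (Suc k)) - t *\<^sub>R r)" by (rule norm_cauchy_schwarz)
  finally have "norm D \<le> norm (incr (Suc (Suc k)) - t *\<^sub>R r)"
    by (cases "D = 0") (auto simp: mult_le_cancel_left)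
  also have "\<dots> \<le> norm (incr (Suc (Suc k))) + t * norm r"
    using norm_triangle_ineq4[of "incr (Suc (Suc k))" "t *\<^sub>R r"] t by simp
  finally have "norm (r' - r) \<le> 2 * norm (incr (Suc (Suc k))) + t * norm r"
    using norm_triangle_ineq4[of "incr (Suc (Suc k))" D] by (simp add: D_eq)
  also have "t * norm r \<le> 3 / real k * norm r" using t by (intro mult_right_mono) auto
  finally show ?thesis by (simp add: r_def r'_def)
qed

lemma regularization_null:
  assumes z: "z \<in> op_inverse A 0"
  shows "(\<lambda>k. lam k *\<^sub>R \<xi> k) \<longlonglongrightarrow> 0"
proof -
  obtain M where M: "\<And>k. k \<ge> K \<Longrightarrow> real k * norm (incr (Suc k)) \<le> M"
    using velocity_bound[OF z] by blast
  obtain R where R: "\<And>k. norm (norm (x k - z)) \<le> R"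
    using convergent_imp_Bseq[OF distance_convergent[OF z]] unfolding Bseq_def by blast
  have "\<bar>norm (lam (Suc k) *\<^sub>R \<xi> (Suc k)) - norm (lam k *\<^sub>R \<xi> k)\<bar> \<le> (2 * M + 3 * R) / real k"
    if "k \<ge> K" for k
  proof -
    have k: "k \<ge> 1" using K(2)[OF that] .
    have r_le: "norm (lam k *\<^sub>R \<xi> k) \<le> R"
      using regularization_le[OF k z] R[of "Suc k"] by simp
    have "real k * norm (incr (Suc (Suc k))) \<le> real (Suc k) * norm (incr (Suc (Suc k)))"
      by (intro mult_right_mono) auto
    also have "\<dots> \<le> M" using M[of "Suc k"] that by simp
    finally have d_le: "norm (incr (Suc (Suc k))) \<le> M / real k" using k by (simp add: field_simps)
    have "\<bar>norm (lam (Suc k) *\<^sub>R \<xi> (Suc k)) - norm (lam k *\<^sub>R \<xi> k)\<bar>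
        \<le> 2 * norm (incr (Suc (Suc k))) + 3 / real k * norm (lam k *\<^sub>R \<xi> k)"
      using regularization_increment[OF k] norm_triangle_ineq3 order_trans by blast
    also have "\<dots> \<le> 2 * (M / real k) + 3 / real k * R"
      by (intro add_mono mult_left_mono r_le d_le) auto
    finally show ?thesis by (simp add: add_divide_distrib)
  qed
  then have "\<forall>\<^sub>F k in sequentially.
      \<bar>norm (lam (Suc k) *\<^sub>R \<xi> (Suc k)) - norm (lam k *\<^sub>R \<xi> k)\<bar> \<le> (2 * M + 3 * R) / real k"
    by (auto simp: eventually_sequentially)
  with summable_regularization[OF z] have "(\<lambda>k. norm (lam k *\<^sub>R \<xi> k)) \<longlonglongrightarrow> 0"
    by (intro null_of_log_integrable) auto
  then show ?thesis by (rule tendsto_norm_zero_cancel)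
qed

end

section \<open>Convergence of the algorithm\<close>

theorem theorem3p6:
  fixes A :: "'a::{real_inner, complete_space} \<Rightarrow> 'a set"
    and s \<alpha> \<epsilon> :: real
    and lam :: "nat \<Rightarrow> real"
    and x y :: "nat \<Rightarrow> 'a"
  assumes "maximally_monotone A"
    and "op_inverse A 0 \<noteq> {}"
    and "s > 0"
    and "\<alpha> > 2"
    and "\<epsilon> > 2 / (\<alpha> - 2)"
    and "\<And>k. k \<ge> 1 \<Longrightarrow> lam k = (1 + \<epsilon>) * (s / \<alpha>\<^sup>2) * (real k)\<^sup>2"
    and "\<And>k. k \<ge> 1 \<Longrightarrow> y k = x k + (1 - \<alpha> / real k) *\<^sub>R (x k - x (k - 1))"
    and "\<And>k. k \<ge> 1 \<Longrightarrow> x (k + 1) =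
           (lam k / (lam k + s)) *\<^sub>R y k + (s / (lam k + s)) *\<^sub>R resolvent (lam k + s) A (y k)"
  shows "(\<lambda>k. norm (x (k + 1) - x k)) \<longlonglongrightarrow> 0
    \<and> (\<lambda>k. norm (x (k + 1) - x k)) \<in> O(\<lambda>k. 1 / real k)
    \<and> summable (\<lambda>k. real k * (norm (x k - x (k - 1)))\<^sup>2)
    \<and> (\<exists>xhat \<in> op_inverse A 0. weakly_converges x xhat \<and> weakly_converges y xhat)"
proof -
  note A = assms(1) and s = assms(3) and lam = assms(6) and y = assms(7) and x = assms(8)
  have mono: "monotone_op A" using A by (simp add: maximally_monotone_def)
  have eps0: "1 + \<epsilon> > 0" using assms(4,5) by (smt (verit) zero_less_divide_iff)
  have lam_pos: "lam k > 0" if "k \<ge> 1" for k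
    using lam[OF that] that eps0 s \<open>\<alpha> > 2\<close> by simp
  define p where "p k = resolvent (lam k + s) A (y k)" for k
  define \<xi> where "\<xi> k = (1 / (lam k + s)) *\<^sub>R (y k - p k)" for k
  have \<xi>_mem: "\<xi> k \<in> A (p k)" if "k \<ge> 1" for k
    using resolvent_mem[OF A, of "lam k + s" "y k"] lam_pos[OF that] s by (simp add: \<xi>_def p_def)
  have p_y: "p k = y k - (lam k + s) *\<^sub>R \<xi> k" if "k \<ge> 1" for k
    using lam_pos[OF that] s by (simp add: \<xi>_def)
  \<comment> \<open>Eliminating the resolvent turns the relaxed proximal step into a Yosida step.\<close>
  have step: "x (Suc k) = y k - s *\<^sub>R \<xi> k" if "k \<ge> 1" for k
  proof -
    have "x (Suc k) = (lam k / (lam k + s)) *\<^sub>R y k + (s / (lam k + s)) *\<^sub>R p k"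
      using x[OF that] by (simp add: p_def)
    also have "\<dots> = (lam k / (lam k + s) + s / (lam k + s)) *\<^sub>R y k
        - (s / (lam k + s) * (lam k + s)) *\<^sub>R \<xi> k"
      unfolding p_y[OF that]
      by (simp only: scaleR_add_left[of "lam k / (lam k + s)"] scaleR_diff_right scaleR_scaleR add_diff_eq)
    also have "\<dots> = y k - s *\<^sub>R \<xi> k"
      using lam_pos[OF that] s by (simp add: add_divide_distrib[symmetric])
    finally show ?thesis .
  qed
  have p_eq: "p k = x (Suc k) - lam k *\<^sub>R \<xi> k" if "k \<ge> 1" for k
    using p_y[OF that] step[OF that] by (simp add: scaleR_add_left)
  interpret regularized_inertial_proximal A s \<alpha> \<epsilon> lam x y \<xi>
    using mono s assms(4,5) lam y step \<xi>_mem p_eq by unfold_locales auto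
  obtain z where z: "z \<in> op_inverse A 0" using assms(2) by blast

  obtain M where M: "\<And>k. k \<ge> K \<Longrightarrow> real k * norm (incr (Suc k)) \<le> M"
    using velocity_bound[OF z] by blast
  have ev: "\<forall>\<^sub>F k in sequentially. norm (norm (x (k + 1) - x k)) \<le> M * norm (1 / real k)"
    using eventually_ge_at_top[of K]
  proof eventually_elim
    case (elim k)
    then show ?case using M[of k] K(2)[of k] by (simp add: incr_def field_simps)
  qed
  then have bigo: "(\<lambda>k. norm (x (k + 1) - x k)) \<in> O(\<lambda>k. 1 / real k)" by (rule bigoI)
  have speed: "(\<lambda>k. norm (x (k + 1) - x k)) \<longlonglongrightarrow> 0"
    proof (rule Lim_null_comparison)
    have "(\<lambda>k. M * (1 / real k)) \<longlonglongrightarrow> M * 0" by (intro tendsto_intros lim_1_over_n)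
    then show "(\<lambda>k. M * (1 / real k)) \<longlonglongrightarrow> 0" by simp
  qed (use ev in simp)

  define T where "T = resolvent 1 A"
  have T: "T u = u \<longleftrightarrow> u \<in> op_inverse A 0" for u
    unfolding T_def by (rule resolvent_fixed_iff[OF A]) simp
  have nonexp: "norm (T a - T b) \<le> norm (a - b)" for a b
    unfolding T_def by (rule resolvent_nonexpansive[OF A]) simp
  have reg: "(\<lambda>k. lam k *\<^sub>R \<xi> k) \<longlonglongrightarrow> 0" by (rule regularization_null[OF z])
  have "(\<lambda>k. x (Suc k) - T (x (Suc k))) \<longlonglongrightarrow> 0"
  proof (rule Lim_null_comparison)
    have "(\<lambda>k. (2 + 1 / lam 1) * norm (lam k *\<^sub>R \<xi> k)) \<longlonglongrightarrow> (2 + 1 / lam 1) * 0"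
      by (intro tendsto_intros tendsto_norm_zero reg)
    then show "(\<lambda>k. (2 + 1 / lam 1) * norm (lam k *\<^sub>R \<xi> k)) \<longlonglongrightarrow> 0" by simp
    show "\<forall>\<^sub>F k in sequentially. norm (x (Suc k) - T (x (Suc k))) \<le> (2 + 1 / lam 1) * norm (lam k *\<^sub>R \<xi> k)"
      using eventually_ge_at_top[of 1]
    proof eventually_elim
      case (elim k)
      have "(1 + \<epsilon>) * (s / \<alpha>\<^sup>2) * 1 \<le> (1 + \<epsilon>) * (s / \<alpha>\<^sup>2) * (real k)\<^sup>2"
        using elim eps0 s by (intro mult_left_mono) auto
      then have "lam 1 \<le> lam k" using lam[OF elim] lam[of 1] by simp
      then have "lam 1 * norm (\<xi> k) \<le> norm (lam k *\<^sub>R \<xi> k)"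
        using lam_pos[OF elim] by (simp add: mult_right_mono)
      then have xi: "norm (\<xi> k) \<le> 1 / lam 1 * norm (lam k *\<^sub>R \<xi> k)"
        using lam_pos[of 1] by (simp add: field_simps)
      \<comment> \<open>\<open>\<xi> k \<in> A (p k)\<close> exhibits \<open>p k\<close> as a resolvent of index 1, so nonexpansiveness compares it with
  \<open>T (x (Suc k))\<close>.\<close>
      have "p k = T (p k + \<xi> k)"
        using resolvent_eq[OF mono _ \<xi>_mem[OF elim], of 1] by (simp add: T_def)
      then have "norm (p k - T (x (Suc k))) \<le> norm (p k + \<xi> k - x (Suc k))"
        using nonexp by metis
      also have "\<dots> \<le> norm (\<xi> k) + norm (lam k *\<^sub>R \<xi> k)"
        using norm_triangle_ineq4[of "\<xi> k" "lam k *\<^sub>R \<xi> k"] by (simp add: p_eq[OF elim])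
      finally have "norm (p k - T (x (Suc k))) \<le> norm (\<xi> k) + norm (lam k *\<^sub>R \<xi> k)" .
      moreover have "x (Suc k) - T (x (Suc k)) = lam k *\<^sub>R \<xi> k + (p k - T (x (Suc k)))"
        by (simp add: p_eq[OF elim])
      then have "norm (x (Suc k) - T (x (Suc k)))
          \<le> norm (lam k *\<^sub>R \<xi> k) + norm (p k - T (x (Suc k)))"
        by (metis norm_triangle_ineq)
      ultimately have "norm (x (Suc k) - T (x (Suc k))) \<le> 2 * norm (lam k *\<^sub>R \<xi> k) + norm (\<xi> k)"
        by linarith
      with xi show ?case unfolding distrib_right by linarith
    qed
  qed
  then have "(\<lambda>k. x k - T (x k)) \<longlonglongrightarrow> 0" by (rule LIMSEQ_imp_Suc)
  then obtain u where u: "T u = u" "weakly_converges x u"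
    using weak_convergence_to_fixed_point[of T z x] nonexp z distance_convergent T by blast

  have "(\<lambda>k. y k - x k) \<longlonglongrightarrow> 0"
  proof (rule Lim_null_comparison)
    have "(\<lambda>k. norm (x (Suc k) - x (Suc k - 1))) \<longlonglongrightarrow> 0" using speed by simp
    then show "(\<lambda>k. norm (x k - x (k - 1))) \<longlonglongrightarrow> 0" by (rule LIMSEQ_imp_Suc)
    show "\<forall>\<^sub>F k in sequentially. norm (y k - x k) \<le> norm (x k - x (k - 1))"
      using eventually_ge_at_top[of K]
    proof eventually_elim
      case (elim k)
      have "\<bar>1 - \<alpha> / real k\<bar> \<le> 1" using K[OF elim] alpha by (simp add: field_simps)
      then show ?case
        using y[OF K(2)[OF elim]] by (simp add: mult_left_le_one_le)
    qed
  qed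
  then have "(\<lambda>k. inner (x k) v + inner (y k - x k) v) \<longlonglongrightarrow> inner u v + inner 0 v" for v
    by (rule tendsto_add[OF _ tendsto_inner[OF _ tendsto_const], rotated])
      (use u(2) in \<open>simp add: weakly_converges_def\<close>)
  then have "weakly_converges y u" by (simp add: weakly_converges_def inner_diff_left)
  with bigo speed summable_velocity[OF z] u T show ?thesis
    by (auto simp: incr_def[abs_def])
qed

end
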